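(* Let $N,\ell,d$ be integers satisfying $1\le N-1\le\ell<d$ and suppose that $A_1,\ldots,A_N\in M_d(\mathbb{R})$ are linear maps all of which are contracting with respect to some fixed norm on $\mathbb{R}^d$. Let $\mathcal{Z}_\ell$ denote the set of all $(v_1,\ldots,v_N)\in\bigoplus_{i=1}^N\mathbb{R}^d\simeq\mathbb{R}^{dN}$ with the property that the affine maps $T_1,\ldots,T_N\colon\mathbb{R}^d\to\mathbb{R}^d$ defined by $T_ix:=A_ix+v_i$ preserve an affine subspace $X\subseteq\mathbb{R}^d$ of dimension less than or equal to $\ell$. Then: (i) The set $\mathcal{Z}_\ell$ is a subvariety of $\bigoplus_{i=1}^N\mathbb{R}^d$, and in particular either $\mathcal{Z}_\ell=\bigoplus_{i=1}^N\mathbb{R}^d$ or $\mathcal{Z}_\ell$ has zero Lebesgue measure. (ii) We have $\mathcal{Z}_\ell=\bigoplus_{i=1}^N\mathbb{R}^d$ if and only if the following property holds: for every $(N-1)$-dimensional vector subspace $U$ of $\mathbb{R}^d$ there exists a vector subspace $W$ of $\mathbb{R}^d$ which has dimension at most $\ell$, satisfies $U\subseteq W$, and satisfies $AW\subseteq W$ for every $A$ in the subalgebra of $M_d(\mathbb{R})$ generated by $A_1,A_2,\ldots,A_N$.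
   Context: $M_d(\mathbb{R})$ is the algebra of real $d\times d$ matrices, identified with linear maps $\mathbb{R}^d\to\mathbb{R}^d$. The $A_i$ are contracting with respect to a fixed norm $\|\cdot\|$ on $\mathbb{R}^d$ (not necessarily Euclidean, the same for all $i$) if for each $i$ there is $c<1$ with $\|A_ix\|\le c\|x\|$ for all $x\in\mathbb{R}^d$. An affine subspace is a translate of a vector subspace (in particular nonempty), with the dimension of that vector subspace. The maps $T_1,\ldots,T_N$ preserve $X$ if $T_iX\subseteq X$ for every $i=1,\ldots,N$ (the same $X$ for all $i$). A subvariety of $\mathbb{R}^m$ is any set equal to the intersection of the zero loci of a collection of polynomial functions $\mathbb{R}^m\to\mathbb{R}$. *)

theory Defs
  imports "HOL-Analysis.Analysis"
begin

definition is_norm :: "('a::real_vector \<Rightarrow> real) \<Rightarrow> bool" where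
  "is_norm \<nu> \<longleftrightarrow>
     (\<forall>x. 0 \<le> \<nu> x) \<and>
     (\<forall>x. \<nu> x = 0 \<longleftrightarrow> x = 0) \<and>
     (\<forall>c x. \<nu> (c *\<^sub>R x) = \<bar>c\<bar> * \<nu> x) \<and>
     (\<forall>x y. \<nu> (x + y) \<le> \<nu> x + \<nu> y)"

definition contracting_wrt :: "(real^'d \<Rightarrow> real) \<Rightarrow> real^'d^'d \<Rightarrow> bool" where
  "contracting_wrt \<nu> A \<longleftrightarrow> (\<exists>c<1. \<forall>x. \<nu> (A *v x) \<le> c * \<nu> x)"

(* The library constant real_polynomial_function is the closure of the bounded linear
   functionals and the constants under sums and products; on a Euclidean space these are
   exactly the polynomial functions in the coordinates. *)
definition subvariety :: "'a::euclidean_space set \<Rightarrow> bool" where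
  "subvariety Z \<longleftrightarrow>
     (\<exists>P. (\<forall>p\<in>P. real_polynomial_function p) \<and> Z = {x. \<forall>p\<in>P. p x = 0})"

(* The product of matrices is **; the operation * on vectors is componentwise.
   Subalgebras are taken to be unital, which does not affect the family of invariant
   subspaces, since the identity matrix preserves every subspace. *)
definition matrix_subalgebra :: "(real^'d^'d) set \<Rightarrow> bool" where
  "matrix_subalgebra S \<longleftrightarrow>
     subspace S \<and> mat 1 \<in> S \<and> (\<forall>B\<in>S. \<forall>C\<in>S. B ** C \<in> S)"

definition generated_subalgebra :: "(real^'d^'d) set \<Rightarrow> (real^'d^'d) set" where
  "generated_subalgebra G = matrix_subalgebra hull G"

(* A tuple of N vectors in R^d is an element of real^'d^'n with CARD('n) = N and
   CARD('d) = d.  The empty set is affine in the library (with aff_dim equal to -1), so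
   nonemptiness of X has to be required. *)
definition invariant_translations :: "('n \<Rightarrow> real^'d^'d) \<Rightarrow> nat \<Rightarrow> (real^'d^'n) set" where
  "invariant_translations A l =
     {v. \<exists>X. affine X \<and> X \<noteq> {} \<and> aff_dim X \<le> int l \<and>
             (\<forall>i. (\<lambda>x. A i *v x + v $ i) ` X \<subseteq> X)}"

end

theory Submission
  imports Defs
begin

text \<open>
  Let \<open>z i\<close> be the unique fixed point of \<open>x \<mapsto> A i x + v i\<close>; it depends linearly on \<open>v\<close>. An invariant
  affine subspace contains every \<open>z i\<close>, so one of dimension at most \<open>l\<close> exists iff the smallest
  \<open>A\<close>-invariant subspace containing the differences \<open>z i - z j\<close> (for a fixed \<open>j\<close>) has dimension at
  most \<open>l\<close>. That subspace is spanned by the vectors \<open>B (z i - z j)\<close> with \<open>B\<close> in the generated algebra,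
  which are linear in \<open>v\<close>, so this is a rank condition on \<open>v\<close>. Since the \<open>z i\<close> can be prescribed
  arbitrarily, their differences span an arbitrary subspace of dimension at most \<open>N - 1\<close>.
\<close>

section \<open>Zero sets of nonzero polynomials are negligible\<close>

text \<open>The degree bound \<open>D\<close> is uniform over all lines, so that a single bound on
  the number of zeros later serves every line through a given point. Degrees take the maximum under
  sums and add up under products.\<close>

lemma real_polynomial_function_on_line:
  fixes p :: "'a::real_normed_vector \<Rightarrow> real"
  assumes "real_polynomial_function p"
  shows "\<exists>D. \<forall>x y. \<exists>q. degree q \<le> D \<and> (\<forall>t. p (x + t *\<^sub>R y) = poly q t)"
  using assms
proof induction
  case (linear f)
  then interpret bounded_linear f .
  show ?case
  proof (rule exI[of _ 1], intro allI)
    fix x y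
    show "\<exists>q. degree q \<le> 1 \<and> (\<forall>t. f (x + t *\<^sub>R y) = poly q t)"
      by (intro exI[of _ "[:f x, f y:]"]) (auto simp: add scaleR)
  qed
next
  case (const c)
  show ?case
  proof (rule exI[of _ 0], intro allI)
    show "\<exists>q. degree q \<le> 0 \<and> (\<forall>t. c = poly q t)"
      by (intro exI[of _ "[:c:]"]) auto
  qed
next
  case (add f g)
  then obtain D E where
    D: "\<forall>x y. \<exists>q. degree q \<le> D \<and> (\<forall>t. f (x + t *\<^sub>R y) = poly q t)" and
    E: "\<forall>x y. \<exists>q. degree q \<le> E \<and> (\<forall>t. g (x + t *\<^sub>R y) = poly q t)" by blast
  show ?case
  proof (intro exI[of _ "max D E"] allI)
    fix x y
    obtain q r where "degree q \<le> D" "\<forall>t. f (x + t *\<^sub>R y) = poly q t"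
      "degree r \<le> E" "\<forall>t. g (x + t *\<^sub>R y) = poly r t" using D E by meson
    then show "\<exists>q. degree q \<le> max D E \<and> (\<forall>t. f (x + t *\<^sub>R y) + g (x + t *\<^sub>R y) = poly q t)"
      by (intro exI[of _ "q + r"]) (auto intro!: degree_add_le)
  qed
next
  case (mult f g)
  then obtain D E where
    D: "\<forall>x y. \<exists>q. degree q \<le> D \<and> (\<forall>t. f (x + t *\<^sub>R y) = poly q t)" and
    E: "\<forall>x y. \<exists>q. degree q \<le> E \<and> (\<forall>t. g (x + t *\<^sub>R y) = poly q t)" by blast
  show ?case
  proof (intro exI[of _ "D + E"] allI)
    fix x y
    obtain q r where qr: "degree q \<le> D" "\<forall>t. f (x + t *\<^sub>R y) = poly q t"
      "degree r \<le> E" "\<forall>t. g (x + t *\<^sub>R y) = poly r t" using D E by meson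
    then have "degree (q * r) \<le> D + E"
      using degree_mult_le[of q r] by linarith
    with qr show "\<exists>q. degree q \<le> D + E \<and> (\<forall>t. f (x + t *\<^sub>R y) * g (x + t *\<^sub>R y) = poly q t)"
      by (intro exI[of _ "q * r"]) auto
  qed
qed

text \<open>Dilate a bounded piece of the zero set about \<open>a\<close> by infinitely many factors in \<open>(1, 2]\<close>. A
  point lies in a bounded number of these copies, as \<open>p\<close> has boundedly many zeros on its line
  through \<open>a\<close>; yet each copy is at least as large as the piece and all lie in one ball.\<close>

lemma negligible_zeros_real_polynomial_function:
  fixes p :: "'a::euclidean_space \<Rightarrow> real"
  assumes p: "real_polynomial_function p" and a: "p a \<noteq> 0"
  shows "negligible {x. p x = 0}"
proof -
  obtain D where D: "\<forall>x y. \<exists>q. degree q \<le> D \<and> (\<forall>t. p (x + t *\<^sub>R y) = poly q t)"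
    using real_polynomial_function_on_line[OF p] by blast
  have "continuous_on UNIV p"
    using p by (simp add: real_polynomial_function_eq continuous_on_polymonial_function)
  then have cl: "closed {x. p x = 0}"
    by (intro closed_Collect_eq continuous_intros)
  have ball: "negligible ({x. p x = 0} \<inter> ball a R)" for R
  proof -
    define S where "S = {x. p x = 0} \<inter> ball a R"
    \<comment> \<open>Factors above 1 keep measures from shrinking, factors of at most 2 keep all
      copies inside \<open>ball a (2 * R)\<close>, and the factors are pairwise distinct.\<close>
    define t :: "nat \<Rightarrow> real" where "t k = 1 + 1 / real (Suc k)" for k
    define T where "T k = (\<lambda>x. t k *\<^sub>R x + (1 - t k) *\<^sub>R a) ` S" for k
    have t: "1 < t k" "t k \<le> 2" for k
      by (auto simp: t_def)
    have inj: "inj (\<lambda>k. 1 / t k)"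
      by (auto simp: inj_def t_def)
    have Sborel: "S \<in> sets borel"
      unfolding S_def using cl by auto
    moreover have "bounded S"
      unfolding S_def by (meson bounded_ball bounded_Int)
    ultimately have S: "S \<in> lmeasurable"
      by (intro bounded_set_imp_lmeasurable) auto
    have Tball: "T k \<subseteq> ball a (2 * R)" for k
    proof
      fix y assume "y \<in> T k"
      then obtain x where "x \<in> S" and x: "y = t k *\<^sub>R x + (1 - t k) *\<^sub>R a"
        unfolding T_def by blast
      then have "dist a x < R" by (simp add: S_def)
      have "y - a = t k *\<^sub>R (x - a)" using x by (simp add: algebra_simps)
      then have "dist a y = t k * dist a x"
        using t[of k] by (metis abs_of_pos dist_commute dist_norm less_trans norm_scaleR zero_less_one)
      also have "\<dots> \<le> 2 * dist a x" using t[of k] by (intro mult_right_mono) auto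
      finally show "y \<in> ball a (2 * R)" using \<open>dist a x < R\<close> by simp
    qed
    have T: "T k \<in> lmeasurable" for k
    proof (rule bounded_set_imp_lmeasurable)
      show "bounded (T k)" using Tball bounded_ball bounded_subset by blast
      \<comment> \<open>As the preimage of \<open>S\<close> under the inverse dilation, the copy is
        Borel.\<close>
      have "T k = (\<lambda>y. a + (1 / t k) *\<^sub>R (y - a)) -` S"
      proof (intro set_eqI iffI)
        fix y assume "y \<in> (\<lambda>y. a + (1 / t k) *\<^sub>R (y - a)) -` S"
        moreover have "y = t k *\<^sub>R (a + (1 / t k) *\<^sub>R (y - a)) + (1 - t k) *\<^sub>R a"
          using t[of k] by (simp add: algebra_simps)
        ultimately show "y \<in> T k" unfolding T_def by blast
      next
        fix y assume "y \<in> T k"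
        then obtain x where x: "x \<in> S" "y = t k *\<^sub>R x + (1 - t k) *\<^sub>R a"
          unfolding T_def by blast
        have "y - a = t k *\<^sub>R (x - a)" using x by (simp add: algebra_simps)
        then show "y \<in> (\<lambda>y. a + (1 / t k) *\<^sub>R (y - a)) -` S"
          using x(1) t[of k] by simp
      qed
      moreover have "(\<lambda>y. a + (1 / t k) *\<^sub>R (y - a)) \<in> borel_measurable borel" by simp
      ultimately have "T k \<in> sets borel"
        using Sborel measurable_sets[of "\<lambda>y. a + (1 / t k) *\<^sub>R (y - a)" borel borel S] by simp
      then show "T k \<in> sets lebesgue" by simp
    qed
    have integrable_T: "integrable lebesgue (indicat_real (T k))" for k
      using T[of k] by (intro integrable_real_indicator) (auto simp: fmeasurable_def)
    have integrable_ball: "integrable lebesgue (indicat_real (ball a (2 * R)))"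
      using lmeasurable_ball[of a "2 * R"]
      by (intro integrable_real_indicator)
        (auto simp only: fmeasurable_def mem_Collect_eq infinity_ennreal_def)
    have measT: "measure lebesgue S \<le> measure lebesgue (T k)" for k
    proof -
      have "measure lebesgue (T k) = \<bar>t k\<bar> ^ DIM('a) * measure lebesgue S"
        unfolding T_def by (metis (no_types, lifting) add.commute image_cong measure_lebesgue_affine)
      moreover have "1 \<le> \<bar>t k\<bar> ^ DIM('a)" using t[of k] by (simp add: one_le_power)
      ultimately show ?thesis
        by (simp add: mult_le_cancel_right1 measure_nonneg)
    qed
    have bound: "(\<Sum>k<K. indicat_real (T k) x) \<le> real D * indicat_real (ball a (2 * R)) x" for K x
    proof (cases "x \<in> ball a (2 * R)")
      case True
      obtain q where q: "degree q \<le> D" "\<And>s. p (a + s *\<^sub>R (x - a)) = poly q s"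
        using D by blast
      have "q \<noteq> 0" using q(2)[of 0] a by auto
      \<comment> \<open>The point of \<open>S\<close> that is dilated to \<open>x\<close> sits at
        parameter \<open>1 / t k\<close> of the line \<open>a + s *\<^sub>R (x - a)\<close>.
        Distinct \<open>k\<close> therefore give distinct roots of \<open>q\<close>, which is
        nonzero because \<open>poly q 0 = p a\<close>.\<close>
      have "1 / t k \<in> {s. poly q s = 0}" if "x \<in> T k" for k
      proof -
        from that obtain y where "y \<in> S" and y: "x = t k *\<^sub>R y + (1 - t k) *\<^sub>R a"
          unfolding T_def by blast
        then have "p y = 0" by (simp add: S_def)
        have "x - a = t k *\<^sub>R (y - a)" using y by (simp add: algebra_simps)
        then have "a + (1 / t k) *\<^sub>R (x - a) = y" using t[of k] by simp
        then show ?thesis using q(2)[of "1 / t k"] \<open>p y = 0\<close> by simp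
      qed
      then have "(\<lambda>k. 1 / t k) ` {k\<in>{..<K}. x \<in> T k} \<subseteq> {s. poly q s = 0}" by blast
      then have "card ((\<lambda>k. 1 / t k) ` {k\<in>{..<K}. x \<in> T k}) \<le> card {s. poly q s = 0}"
        using \<open>q \<noteq> 0\<close> by (intro card_mono poly_roots_finite)
      also have "\<dots> \<le> D"
        using \<open>q \<noteq> 0\<close> q(1) card_poly_roots_bound order_trans by blast
      finally have "card {k\<in>{..<K}. x \<in> T k} \<le> D"
        using inj by (simp add: card_image inj_on_subset)
      moreover have "(\<Sum>k<K. indicat_real (T k) x) = real (card {k\<in>{..<K}. x \<in> T k})"
        by (simp add: indicator_def sum.If_cases Int_def)
      ultimately show ?thesis using True by simp
    next
      case False
      then have "x \<notin> T k" for k using Tball by blast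
      then show ?thesis by simp
    qed
    \<comment> \<open>Integrating the overlap bound gives an upper bound independent of
      \<open>K\<close>, which forces the measure of \<open>S\<close> to be zero.\<close>
    have "real K * measure lebesgue S \<le> real D * measure lebesgue (ball a (2 * R))" for K
    proof -
      have "real K * measure lebesgue S \<le> (\<Sum>k<K. measure lebesgue (T k))"
        using sum_bounded_below[of "{..<K}" "measure lebesgue S" "\<lambda>k. measure lebesgue (T k)"] measT
        by simp
      also have "\<dots> = (\<Sum>k<K. integral\<^sup>L lebesgue (indicat_real (T k)))"
        using T by (simp add: lmeasure_integral_UNIV fmeasurableD)
      also have "\<dots> = integral\<^sup>L lebesgue (\<lambda>x. \<Sum>k<K. indicat_real (T k) x)"
        using integrable_T by (intro Bochner_Integration.integral_sum[symmetric])
      also have "\<dots> \<le> integral\<^sup>L lebesgue (\<lambda>x. real D * indicat_real (ball a (2 * R)) x)"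
        by (intro integral_mono Bochner_Integration.integrable_sum integrable_mult_right
            integrable_T integrable_ball bound)
      also have "\<dots> = real D * measure lebesgue (ball a (2 * R))"
        by simp
      finally show ?thesis .
    qed
    then have "measure lebesgue S \<le> 0"
      using ex_less_of_nat_mult[of "measure lebesgue S" "real D * measure lebesgue (ball a (2 * R))"]
      by (meson not_less)
    then have "measure lebesgue S = 0" using measure_nonneg[of lebesgue S] by linarith
    then show ?thesis
      using S negligible_iff_measure0 by (auto simp: S_def)
  qed
  have "{x. p x = 0} = (\<Union>n. {x. p x = 0} \<inter> ball a (real n))"
    using reals_Archimedean2 by auto
  then show ?thesis
    using ball negligible_countable_Union[of "range (\<lambda>n. {x. p x = 0} \<inter> ball a (real n))"] by auto
qed

text \<open>A proper subvariety lies in the zero set of a single polynomial that does not vanish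
  identically.\<close>

lemma subvariety_UNIV_or_negligible:
  assumes "subvariety Z"
  shows "Z = UNIV \<or> negligible Z"
proof -
  obtain P where P: "\<forall>p\<in>P. real_polynomial_function p" "Z = {x. \<forall>p\<in>P. p x = 0}"
    using assms unfolding subvariety_def by blast
  show ?thesis
  proof (cases "Z = UNIV")
    case False
    then obtain p a where "p \<in> P" "p a \<noteq> 0" using P by auto
    then have "negligible {x. p x = 0}"
      using negligible_zeros_real_polynomial_function P by blast
    then show ?thesis
      using \<open>p \<in> P\<close> P by (auto intro: negligible_subset)
  qed simp
qed

section \<open>Rank conditions as polynomial equations\<close>

lemma card_extend_basis:
  fixes B :: "(real^'d) set"
  assumes "independent B"
  shows "card (extend_basis B) = CARD('d)"
proof -
  have "card (extend_basis B) = dim (span (extend_basis B))"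
    using dim_eq_card_independent[OF independent_extend_basis[OF assms]] by simp
  also have "\<dots> = CARD('d)"
    unfolding span_extend_basis[OF assms] by simp
  finally show ?thesis .
qed

text \<open>Row rank equals column rank, and a square matrix is nonsingular exactly when its rank is
  full.\<close>

lemma det_rows_nonzero_iff_dim:
  fixes w :: "'d::finite \<Rightarrow> real^'d"
  shows "det (\<chi> i. w i) \<noteq> 0 \<longleftrightarrow> dim (range w) = CARD('d)"
proof -
  have "rows (\<chi> i. w i) = range w"
    by (auto simp: rows_def row_def vec_lambda_eta)
  then have "rank (\<chi> i. w i) = dim (range w)"
    by (simp add: row_rank_def)
  moreover have "rank (\<chi> i. w i) \<le> CARD('d)"
    using rank_bound[of "\<chi> i. w i"] by simp
  ultimately show ?thesis
    by (metis det_eq_0_rank nat_less_le less_irrefl)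
qed

text \<open>The rank condition is cut out by determinants of full size: \<open>l + 1\<close> rows come from the
  family and the remaining rows are constants completing a basis.\<close>

lemma subvariety_dim_le:
  fixes F :: "('a::euclidean_space \<Rightarrow> real^'d) set"
  assumes lin: "\<And>f. f \<in> F \<Longrightarrow> linear f"
  shows "subvariety {v. dim ((\<lambda>f. f v) ` F) \<le> l}"
  unfolding subvariety_def
proof (intro exI conjI)
  define row :: "'d set \<Rightarrow> ('d \<Rightarrow> 'a \<Rightarrow> real^'d) \<Rightarrow> ('d \<Rightarrow> real^'d) \<Rightarrow> 'a \<Rightarrow> 'd \<Rightarrow> real^'d"
    where "row I s c v i = (if i \<in> I then s i v else c i)" for I s c v i
  let ?P = "{\<lambda>v. det (\<chi> i. row I s c v i) | I s c. card I = Suc l \<and> range s \<subseteq> F}"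
  show "\<forall>p\<in>?P. real_polynomial_function p"
  proof clarify
    fix I :: "'d set" and s :: "'d \<Rightarrow> 'a \<Rightarrow> real^'d" and c :: "'d \<Rightarrow> real^'d"
    assume s: "range s \<subseteq> F"
    have "real_polynomial_function (\<lambda>v. row I s c v i $ j)" for i j
    proof (cases "i \<in> I")
      case True
      have "linear (s i)" using lin s by auto
      then have "bounded_linear (\<lambda>v. s i v $ j)"
        by (intro bounded_linear_compose[OF bounded_linear_vec_nth])
          (simp add: linear_conv_bounded_linear)
      then show ?thesis using True by (auto simp: row_def)
    qed (auto simp: row_def)
    then show "real_polynomial_function (\<lambda>v. det (\<chi> i. row I s c v i))"
      unfolding det_def
      by (auto intro!: real_polynomial_function_sum real_polynomial_function.intros(4)
            real_polynomial_function_prod real_polynomial_function.intros(2))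
  qed
  show "{v. dim ((\<lambda>f. f v) ` F) \<le> l} = {v. \<forall>p\<in>?P. p v = 0}"
  proof (intro set_eqI iffI; clarify)
    fix v and I :: "'d set" and s :: "'d \<Rightarrow> 'a \<Rightarrow> real^'d" and c :: "'d \<Rightarrow> real^'d"
    assume le: "dim ((\<lambda>f. f v) ` F) \<le> l" and I: "card I = Suc l" and s: "range s \<subseteq> F"
    obtain B where B: "independent B" "(\<lambda>f. f v) ` F \<subseteq> span B"
      "card B = dim ((\<lambda>f. f v) ` F)"
      using basis_exists by metis
    \<comment> \<open>With \<open>d = CARD('d)\<close>, the family is spanned by at most
      \<open>l\<close> vectors and there are \<open>d - (l + 1)\<close> constant rows, so all rows
      lie in a span of dimension below \<open>d\<close>.\<close>
    have "range (row I s c v) \<subseteq> span (B \<union> c ` (- I))"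
    proof clarify
      fix i
      show "row I s c v i \<in> span (B \<union> c ` (- I))"
      proof (cases "i \<in> I")
        case True
        then have "row I s c v i \<in> span B" using B(2) s by (auto simp: row_def image_subset_iff)
        then show ?thesis using span_mono[of B "B \<union> c ` (- I)"] by blast
      next
        case False
        then show ?thesis by (auto simp: row_def intro: span_base)
      qed
    qed
    then have "dim (range (row I s c v)) \<le> card (B \<union> c ` (- I))"
      using B(1) by (intro dim_le_card) (auto intro: finiteI_independent)
    also have "\<dots> \<le> card B + card (- I)"
      by (meson card_Un_le card_image_le finite add_left_mono order_trans)
    also have "\<dots> < Suc l + card (- I)" using le B by simp
    also have "\<dots> = CARD('d)"
      using card_Un_disjoint[of I "- I"] I by simp
    finally show "det (\<chi> i. row I s c v i) = 0"
      using det_rows_nonzero_iff_dim[of "row I s c v"] by (metis nat_less_le)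
  next
    fix v assume zero: "\<forall>p\<in>?P. p v = 0"
    show "dim ((\<lambda>f. f v) ` F) \<le> l"
    proof (rule ccontr)
      \<comment> \<open>Rank above \<open>l\<close> provides \<open>l + 1\<close> independent values
        at \<open>v\<close>. Completed to a basis \<open>C\<close> and distributed over the row
        indices by \<open>c\<close>, they yield a determinant from the collection that is nonzero at
        \<open>v\<close>.\<close>
      assume "\<not> ?thesis"
      moreover obtain B0 where B0: "independent B0" "B0 \<subseteq> (\<lambda>f. f v) ` F"
        "card B0 = dim ((\<lambda>f. f v) ` F)"
        using basis_exists by metis
      ultimately obtain B where B: "B \<subseteq> B0" "card B = Suc l"
        by (metis not_less_eq_eq obtain_subset_with_card_n)
      define C where "C = extend_basis B"
      have indB: "independent B" using B B0 independent_mono by blast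
      have C: "B \<subseteq> C" "independent C" "span C = UNIV"
        using extend_basis_superset[OF indB] independent_extend_basis[OF indB]
          span_extend_basis[OF indB] by (auto simp: C_def)
      have cardC: "card C = CARD('d)" unfolding C_def by (rule card_extend_basis[OF indB])
      then have dimC: "dim C = CARD('d)" using dim_eq_card_independent[OF C(2)] by simp
      obtain c :: "'d \<Rightarrow> real^'d" where c: "bij_betw c UNIV C"
        using finite_same_card_bij[OF finite[of UNIV] finiteI_independent[OF C(2)]] cardC by auto
      define I where "I = c -` B"
      have "c ` I = B" using c C(1) by (auto simp: I_def bij_betw_def)
      then have I: "card I = Suc l"
        using c B(2) by (metis bij_betw_def card_image inj_on_subset subset_UNIV)
      have "\<forall>b\<in>B. \<exists>f\<in>F. f v = b" using B(1) B0(2) by blast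
      then obtain g where g: "\<And>b. b \<in> B \<Longrightarrow> g b \<in> F \<and> g b v = b" by metis
      \<comment> \<open>\<open>B\<close> has \<open>l + 1\<close> elements, so \<open>F\<close> is
        nonempty. \<open>f0\<close> only fills the entries of \<open>s\<close> outside
        \<open>I\<close>, which \<open>row\<close> never reads.\<close>
      obtain f0 where "f0 \<in> F" using g B(2) by fastforce
      define s where "s i = (if i \<in> I then g (c i) else f0)" for i
      have s: "range s \<subseteq> F" using g \<open>f0 \<in> F\<close> by (auto simp: s_def I_def)
      \<comment> \<open>At this particular \<open>v\<close> the varying rows take exactly the values
        that \<open>c\<close> has on \<open>I\<close>, so the rows of the matrix form the basis
        \<open>C\<close>.\<close>
      have "row I s c v = c"
        using g by (auto simp: row_def s_def I_def fun_eq_iff)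
      then have nz: "det (\<chi> i. row I s c v i) \<noteq> 0"
        using det_rows_nonzero_iff_dim[of c] c dimC by (simp add: bij_betw_def)
      have "(\<lambda>v. det (\<chi> i. row I s c v i)) \<in> ?P"
        using I s by (intro CollectI exI[of _ I] exI[of _ s] exI[of _ c] conjI refl)
      from bspec[OF zero this] have "det (\<chi> i. row I s c v i) = 0" .
      with nz show False by blast
    qed
  qed
qed

section \<open>Invariant subspaces and the generated algebra\<close>

lemma matrix_subalgebra_generated: "matrix_subalgebra (generated_subalgebra G)"
proof -
  have Inter: "matrix_subalgebra (\<Inter>\<S>)" if "\<forall>S\<in>\<S>. matrix_subalgebra S" for \<S> :: "(real^'d^'d) set set"
    using that by (auto simp: matrix_subalgebra_def intro: subspace_Inter)
  show ?thesis
    unfolding generated_subalgebra_def by (rule hull_in) (rule Inter)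
qed

lemma matrix_subalgebra_stabilizer:
  assumes "subspace V"
  shows "matrix_subalgebra {B :: real^'d^'d. \<forall>x\<in>V. B *v x \<in> V}"
  using assms unfolding matrix_subalgebra_def subspace_def
  by (auto simp: matrix_vector_mult_add_rdistrib scaleR_matrix_vector_assoc[symmetric]
      matrix_vector_mul_assoc[symmetric])

text \<open>The matrices that map \<open>V\<close> into itself form a subalgebra; if it contains
  \<open>G\<close>, it contains the hull of \<open>G\<close>.\<close>

lemma invariant_generated_subalgebra:
  assumes "subspace V" and "\<And>B x. B \<in> G \<Longrightarrow> x \<in> V \<Longrightarrow> B *v x \<in> V"
    and "B \<in> generated_subalgebra G" "x \<in> V"
  shows "B *v x \<in> V"
proof -
  have "generated_subalgebra G \<subseteq> {B. \<forall>x\<in>V. B *v x \<in> V}"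
    unfolding generated_subalgebra_def
    using assms(2) matrix_subalgebra_stabilizer[OF assms(1)] by (intro hull_minimal) auto
  then show ?thesis using assms(3,4) by blast
qed

text \<open>The span of the orbit of \<open>D\<close> under the algebra is the smallest
  \<open>G\<close>-invariant subspace containing \<open>D\<close>: closure under products makes it
  invariant, and the identity matrix puts \<open>D\<close> inside it.\<close>

lemma ex_invariant_subspace_iff:
  fixes D :: "(real^'d) set"
  shows "(\<exists>V. subspace V \<and> dim V \<le> l \<and> (\<forall>B\<in>G. \<forall>x\<in>V. B *v x \<in> V) \<and> D \<subseteq> V) \<longleftrightarrow>
    dim {B *v x | B x. B \<in> generated_subalgebra G \<and> x \<in> D} \<le> l" (is "?L \<longleftrightarrow> dim ?O \<le> l")
proof
  assume ?L
  then obtain V where V: "subspace V" "dim V \<le> l" "\<forall>B\<in>G. \<forall>x\<in>V. B *v x \<in> V" "D \<subseteq> V"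
    by blast
  then have "?O \<subseteq> V" using invariant_generated_subalgebra[of V G] by blast
  then show "dim ?O \<le> l" using V(2) dim_subset order_trans by blast
next
  assume le: "dim ?O \<le> l"
  have alg: "matrix_subalgebra (generated_subalgebra G)"
    by (rule matrix_subalgebra_generated)
  have "B *v x \<in> span ?O" if B: "B \<in> G" and x: "x \<in> span ?O" for B x
  proof -
    have "B \<in> generated_subalgebra G"
      using B by (simp add: generated_subalgebra_def hull_inc)
    then have "(*v) B ` ?O \<subseteq> ?O"
      using alg by (auto simp: matrix_subalgebra_def matrix_vector_mul_assoc; blast)
    moreover have "(*v) B ` span ?O = span ((*v) B ` ?O)"
      by (simp add: linear_span_image)
    ultimately show ?thesis using x span_mono by blast
  qed
  moreover have "D \<subseteq> span ?O"
  proof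
    fix x assume "x \<in> D"
    moreover have "mat 1 \<in> generated_subalgebra G" using alg by (simp add: matrix_subalgebra_def)
    ultimately have "mat 1 *v x \<in> ?O" by blast
    then show "x \<in> span ?O" by (auto intro: span_base)
  qed
  ultimately show ?L
    using le by (intro exI[of _ "span ?O"]) auto
qed

section \<open>Fixed points and invariant affine subspaces\<close>

text \<open>Otherwise \<open>\<nu> x\<close> would be positive and at most
  \<open>c * \<nu> x\<close> with \<open>c < 1\<close>. The purpose is the injectivity of
  \<open>1 - A\<close>.\<close>

lemma contracting_wrt_fixed_point:
  assumes "is_norm \<nu>" "contracting_wrt \<nu> A" "A *v x = x"
  shows "x = 0"
proof -
  obtain c where c: "c < 1" "\<nu> x \<le> c * \<nu> x"
    using assms by (metis contracting_wrt_def)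
  have "0 \<le> \<nu> x" using assms by (simp add: is_norm_def)
  moreover have "\<not> 0 < \<nu> x"
    using c mult_strict_right_mono[of c 1 "\<nu> x"] by auto
  ultimately have "\<nu> x = 0" by simp
  then show ?thesis using assms by (simp add: is_norm_def)
qed

text \<open>An invariant affine subspace contains the fixed point of each map, because \<open>1 - A i\<close>
  is injective and hence bijective on its direction space.\<close>

lemma invariant_translations_iff:
  fixes A :: "'n::finite \<Rightarrow> real^'d^'d"
  assumes inj: "\<And>i. inj (\<lambda>x. x - A i *v x)"
    and z: "\<And>i. A i *v z i + v $ i = z i"
  shows "v \<in> invariant_translations A l \<longleftrightarrow>
    (\<exists>V. subspace V \<and> dim V \<le> l \<and> (\<forall>B\<in>range A. \<forall>x\<in>V. B *v x \<in> V) \<and>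
         range (\<lambda>i. z i - z j) \<subseteq> V)"
proof
  assume "v \<in> invariant_translations A l"
  then obtain X where X: "affine X" "X \<noteq> {}" "aff_dim X \<le> int l"
    and inv_X: "\<forall>i. (\<lambda>x. A i *v x + v $ i) ` X \<subseteq> X"
    by (auto simp: invariant_translations_def)
  have TX: "A i *v x + v $ i \<in> X" if "x \<in> X" for i x
    using inv_X that by (simp add: image_subset_iff)
  obtain a where a: "a \<in> X" using X(2) by blast
  define V where "V = (\<lambda>x. x - a) ` X"
  have V: "subspace V" unfolding V_def using X(1) a by (rule affine_diffs_subspace_subtract)
  have memV: "x - a \<in> V \<longleftrightarrow> x \<in> X" for x by (auto simp: V_def)
  have "int (dim V) = aff_dim X"
    using aff_dim_subspace[OF V] by (simp add: V_def aff_dim_translation_eq_subtract)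
  then have dimV: "dim V \<le> l" using X(3) by simp
  have inv: "A i *v x \<in> V" if "x \<in> V" for i x
  proof -
    \<comment> \<open>The translation part cancels in the difference of the images of
      \<open>a + x\<close> and \<open>a\<close>, leaving \<open>A i *v x\<close>.\<close>
    have "(A i *v (a + x) + v $ i - a) - (A i *v a + v $ i - a) \<in> V"
    proof (rule subspace_diff[OF V])
      have "a + x \<in> X" using that memV[of "a + x"] by simp
      then show "A i *v (a + x) + v $ i - a \<in> V" by (simp only: memV TX)
      show "A i *v a + v $ i - a \<in> V" by (simp only: memV TX a)
    qed
    then show ?thesis by (simp add: matrix_vector_right_distrib)
  qed
  have "z i - a \<in> V" for i
  proof -
    let ?f = "\<lambda>x. x - A i *v x"
    have lin: "linear ?f" by (intro linear_compose_sub linear_ident matrix_vector_mul_linear)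
    have "?f ` V = V"
    proof (rule subspace_dim_equal)
      show "subspace (?f ` V)" using lin V by (rule linear_subspace_image)
      show "?f ` V \<subseteq> V" using inv V by (auto intro: subspace_diff)
      show "dim V \<le> dim (?f ` V)"
        using dim_image_eq[OF lin, of V] inj[of i] by (simp add: inj_on_subset)
    qed (rule V)
    moreover have "A i *v a + v $ i - a \<in> V" by (simp add: memV TX a)
    \<comment> \<open>Such a \<open>w\<close> makes \<open>a + w\<close> a fixed point of the
      \<open>i\<close>-th map, hence equal to \<open>z i\<close> by injectivity.\<close>
    ultimately obtain w where w: "w \<in> V" "A i *v a + v $ i - a = w - A i *v w" by blast
    have "?f (a + w) = v $ i"
      using w(2) by (simp add: matrix_vector_right_distrib algebra_simps)
    also have "\<dots> = ?f (z i)"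
      using z[of i] by (simp add: algebra_simps)
    finally have "a + w = z i" using inj injD by metis
    then have "z i - a = w" by (metis add_diff_cancel_left')
    then show ?thesis using w by simp
  qed
  then have "z i - z j \<in> V" for i
    using subspace_diff[OF V, of "z i - a" "z j - a"] by simp
  then show "\<exists>V. subspace V \<and> dim V \<le> l \<and> (\<forall>B\<in>range A. \<forall>x\<in>V. B *v x \<in> V) \<and>
         range (\<lambda>i. z i - z j) \<subseteq> V"
    using V dimV inv by blast
next
  assume "\<exists>V. subspace V \<and> dim V \<le> l \<and> (\<forall>B\<in>range A. \<forall>x\<in>V. B *v x \<in> V) \<and>
         range (\<lambda>i. z i - z j) \<subseteq> V"
  then obtain V where V: "subspace V" "dim V \<le> l" "\<And>i x. x \<in> V \<Longrightarrow> A i *v x \<in> V"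
    "\<And>i. z i - z j \<in> V" by blast
  let ?X = "(+) (z j) ` V"
  have T: "A i *v (z j + x) + v $ i \<in> ?X" if "x \<in> V" for i x
  proof -
    \<comment> \<open>The \<open>i\<close>-th map acts as \<open>A i\<close> about its fixed point
      \<open>z i\<close>, and \<open>z j + x\<close> has displacement \<open>x - (z i - z j)\<close>
      from it.\<close>
    have "A i *v (z j + x) + v $ i = z j + ((z i - z j) + A i *v (x - (z i - z j)))"
      using z[of i] by (simp add: matrix_vector_mult_diff_distrib matrix_vector_right_distrib
          algebra_simps)
    moreover have "(z i - z j) + A i *v (x - (z i - z j)) \<in> V"
      by (rule subspace_add[OF V(1) V(4) V(3)[OF subspace_diff[OF V(1) that V(4)]]])
    ultimately show ?thesis by blast
  qed
  have "(\<lambda>x. A i *v x + v $ i) ` ?X \<subseteq> ?X" for i using T by blast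
  moreover have "affine ?X" using V(1) by (simp add: affine_translation[symmetric] subspace_imp_affine)
  moreover have "aff_dim ?X \<le> int l"
    using V by (simp add: aff_dim_translation_eq aff_dim_subspace)
  moreover have "?X \<noteq> {}" using V(1) subspace_0 by blast
  ultimately show "v \<in> invariant_translations A l"
    unfolding invariant_translations_def
    by (intro CollectI exI[of _ ?X] conjI allI)
qed

section \<open>Fixed points as linear functions of the translations, and both claims\<close>

theorem theorem3:
  fixes A :: "'n::finite \<Rightarrow> real^'d^'d"
    and l :: nat
    and \<nu> :: "real^'d \<Rightarrow> real"
  assumes "1 \<le> CARD('n) - 1" and "CARD('n) - 1 \<le> l" and "l < CARD('d)"
    and "is_norm \<nu>"
    and "\<And>i. contracting_wrt \<nu> (A i)"
  shows "(subvariety (invariant_translations A l) \<and>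
          (invariant_translations A l = UNIV \<or>
           invariant_translations A l \<in> null_sets lebesgue)) \<and>
         (invariant_translations A l = UNIV \<longleftrightarrow>
          (\<forall>U :: (real^'d) set. subspace U \<and> dim U = CARD('n) - 1 \<longrightarrow>
             (\<exists>W. subspace W \<and> dim W \<le> l \<and> U \<subseteq> W \<and>
                  (\<forall>B\<in>generated_subalgebra (range A). (\<lambda>x. B *v x) ` W \<subseteq> W))))"
proof -
  let ?S = "generated_subalgebra (range A)"
  have fix0: "x = 0" if "A i *v x = x" for i x
    using contracting_wrt_fixed_point assms(4,5) that by blast
  have lin: "linear (\<lambda>x. x - A i *v x)" for i
    by (intro linear_compose_sub linear_ident matrix_vector_mul_linear)
  have inj: "inj (\<lambda>x. x - A i *v x)" for i
    using fix0[of i] by (simp add: linear_injective_0[OF lin])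
  \<comment> \<open>\<open>g\<close> is the inverse of \<open>1 - A i\<close>: it sends a
    translation vector to the fixed point of the resulting map, linearly.\<close>
  have "\<exists>g. linear g \<and> (\<forall>y. A i *v g y + y = g y)" for i
  proof -
    obtain g where g: "linear g" "\<forall>x. g x - A i *v g x = x"
      using linear_injective_isomorphism[OF lin inj] by blast
    then show ?thesis by (metis diff_add_cancel add.commute)
  qed
  then obtain g where g: "\<And>i. linear (g i)" "\<And>i y. A i *v g i y + y = g i y" by metis
  \<comment> \<open>Any fixed index can serve as the base point of the differences.\<close>
  define j :: 'n where "j = undefined"
  define z where "z v i = g i (v $ i)" for v :: "real^'d^'n" and i
  have z: "A i *v z v i + v $ i = z v i" for v i by (simp add: z_def g)
  note iff = invariant_translations_iff[of A, OF inj z, where j = j]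
  \<comment> \<open>These functions are linear in \<open>v\<close>, and their values at
    \<open>v\<close> are the orbit of the differences of fixed points under the algebra. Hence the
    rank condition describes the invariant translations.\<close>
  define F where "F = (\<lambda>(B, i) v. B *v (z v i - z v j)) ` (?S \<times> UNIV)"
  have "linear (\<lambda>v. B *v (z v i - z v j))" for B :: "real^'d^'d" and i
  proof -
    have "linear (\<lambda>v. z v i)" for i
      unfolding z_def
      using linear_compose[OF bounded_linear.linear[OF bounded_linear_vec_nth] g(1)]
      by (simp add: o_def)
    then have "linear (\<lambda>v. z v i - z v j)" by (intro linear_compose_sub)
    then show ?thesis
      using linear_compose[OF _ matrix_vector_mul_linear] by (simp add: o_def)
  qed
  then have "linear f" if "f \<in> F" for f
    using that by (auto simp: F_def)
  then have "subvariety {v. dim ((\<lambda>f. f v) ` F) \<le> l}" by (rule subvariety_dim_le)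
  also have "{v. dim ((\<lambda>f. f v) ` F) \<le> l} = invariant_translations A l"
  proof (intro set_eqI)
    fix v
    have "(\<lambda>f. f v) ` F = (\<lambda>(B, i). B *v (z v i - z v j)) ` (?S \<times> UNIV)"
      by (simp add: F_def image_image case_prod_unfold)
    also have "\<dots> = {B *v x | B x. B \<in> ?S \<and> x \<in> range (\<lambda>i. z v i - z v j)}"
      by auto
    finally show "v \<in> {v. dim ((\<lambda>f. f v) ` F) \<le> l} \<longleftrightarrow> v \<in> invariant_translations A l"
      by (simp only: iff ex_invariant_subspace_iff mem_Collect_eq)
  qed
  finally have sub: "subvariety (invariant_translations A l)" .
  have gen: "(\<forall>B\<in>?S. (\<lambda>x. B *v x) ` W \<subseteq> W) \<longleftrightarrow> (\<forall>B\<in>range A. \<forall>x\<in>W. B *v x \<in> W)"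
    if "subspace W" for W
  proof
    assume "\<forall>B\<in>range A. \<forall>x\<in>W. B *v x \<in> W"
    then show "\<forall>B\<in>?S. (\<lambda>x. B *v x) ` W \<subseteq> W"
      using invariant_generated_subalgebra[OF that, of "range A"] by blast
  next
    assume "\<forall>B\<in>?S. (\<lambda>x. B *v x) ` W \<subseteq> W"
    moreover have "range A \<subseteq> ?S" by (simp add: generated_subalgebra_def hull_subset)
    ultimately show "\<forall>B\<in>range A. \<forall>x\<in>W. B *v x \<in> W" by blast
  qed
  have cardj: "card (UNIV - {j}) = CARD('n) - 1" by simp
  have "invariant_translations A l = UNIV \<longleftrightarrow>
          (\<forall>U :: (real^'d) set. subspace U \<and> dim U = CARD('n) - 1 \<longrightarrow>
             (\<exists>W. subspace W \<and> dim W \<le> l \<and> U \<subseteq> W \<and> (\<forall>B\<in>?S. (\<lambda>x. B *v x) ` W \<subseteq> W)))"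
    (is "_ \<longleftrightarrow> ?R")
  proof
    assume UNIV: "invariant_translations A l = UNIV"
    show ?R
    proof clarify
      fix U :: "(real^'d) set" assume U: "subspace U" "dim U = CARD('n) - 1"
      obtain B where B: "B \<subseteq> U" "independent B" "U \<subseteq> span B" "card B = dim U"
        using basis_exists by metis
      then obtain u where u: "bij_betw u (UNIV - {j}) B"
        using U(2) cardj by (metis finite finiteI_independent finite_same_card_bij)
      \<comment> \<open>Fixed points are prescribed first: the origin for \<open>j\<close> and a
        basis of \<open>U\<close> for the other \<open>N - 1\<close> indices. Then \<open>v\<close>
        is solved for, and the differences \<open>y i - y j\<close> span \<open>U\<close>.\<close>
      define y where "y i = (if i = j then 0 else u i)" for i
      define v where "v = (\<chi> i. y i - A i *v y i)"
      have y: "A i *v y i + v $ i = y i" for i by (simp add: v_def)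
      have "v \<in> invariant_translations A l" using UNIV by simp
      then obtain V where V: "subspace V" "dim V \<le> l" "\<forall>B\<in>range A. \<forall>x\<in>V. B *v x \<in> V"
        "range (\<lambda>i. y i - y j) \<subseteq> V"
        using invariant_translations_iff[of A, OF inj y, where j = j] by blast
      have "B \<subseteq> V"
      proof
        fix b assume "b \<in> B"
        then obtain i where "i \<noteq> j" "b = u i" using u by (auto simp: bij_betw_def)
        then have "b = y i - y j" by (simp add: y_def)
        then show "b \<in> V" using V(4) by blast
      qed
      then have "U \<subseteq> V" using B(3) V(1) span_minimal by blast
      then show "\<exists>W. subspace W \<and> dim W \<le> l \<and> U \<subseteq> W \<and> (\<forall>B\<in>?S. (\<lambda>x. B *v x) ` W \<subseteq> W)"
        using V gen by blast
    qed
  next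
    assume R: ?R
    have "v \<in> invariant_translations A l" for v
    proof -
      let ?D = "range (\<lambda>i. z v i - z v j)"
      \<comment> \<open>The difference at index \<open>j\<close> is zero, so only
        \<open>N - 1\<close> vectors contribute.\<close>
      have "?D \<subseteq> span ((\<lambda>i. z v i - z v j) ` (UNIV - {j}))"
      proof clarify
        fix i
        show "z v i - z v j \<in> span ((\<lambda>i. z v i - z v j) ` (UNIV - {j}))"
          by (cases "i = j") (auto simp: span_zero intro: span_base)
      qed
      then have "dim ?D \<le> card ((\<lambda>i. z v i - z v j) ` (UNIV - {j}))"
        by (intro dim_le_card) auto
      also have "\<dots> \<le> CARD('n) - 1" using card_image_le cardj by (metis finite)
      finally have dimD: "dim ?D \<le> CARD('n) - 1" .
      obtain B where B: "independent B" "?D \<subseteq> span B" "card B = dim ?D"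
        using basis_exists by metis
      \<comment> \<open>The differences may span less than dimension \<open>N - 1\<close>, while the
        property concerns subspaces of exactly that dimension. A basis of their span is therefore
        enlarged inside a basis of the whole space, where \<open>N - 1 \<le> l < d\<close> leaves
        room.\<close>
      let ?E = "extend_basis B"
      have E: "B \<subseteq> ?E" "independent ?E" "card ?E = CARD('d)"
        using extend_basis_superset[OF B(1)] independent_extend_basis[OF B(1)]
          card_extend_basis[OF B(1)]
        by auto
      obtain C where C: "B \<subseteq> C" "C \<subseteq> ?E" "card C = CARD('n) - 1"
        using exists_subset_between[of B "CARD('n) - 1" ?E] B(3) E dimD assms(2,3)
          finiteI_independent[OF E(2)] by auto
      have "dim (span C) = CARD('n) - 1"
        using C E(2) by (metis dim_span dim_eq_card_independent independent_mono)
      then obtain W where W: "subspace W" "dim W \<le> l" "span C \<subseteq> W"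
        "\<forall>B\<in>?S. (\<lambda>x. B *v x) ` W \<subseteq> W"
        using R subspace_span by blast
      have "?D \<subseteq> W" using B(2) span_mono[OF C(1)] W(3) by blast
      then show ?thesis using W gen[OF W(1)] by (simp only: iff) blast
    qed
    then show "invariant_translations A l = UNIV" by blast
  qed
  then show ?thesis
    using sub subvariety_UNIV_or_negligible[OF sub] negligible_iff_null_sets by blast
qed

end
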